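(* Let $(S_n)_{n\ge0}$ be the Dynamic Elephant Random Walk with $p=1/2$, and suppose that the limit $\ell(\alpha)=\lim_{n\to\infty}g(\alpha,n)$ exists and $\ell(\alpha)>0$. Then, for $\mu$-almost every $x\in\mathcal{X}$, $$\lim_{n\to\infty}\frac{S_n}{n}=(1-\ell(\alpha))\bigl(2\,\mathbb{E}_\mu[f\mid\mathcal{I}](x)-1\bigr)\qquad \mathbb{P}_x\text{-almost surely},$$ where $\mathcal{I}$ is the $\sigma$-algebra of $T$-invariant sets and $\mathbb{E}_\mu[f\mid\mathcal{I}]$ is the conditional expectation under $\mu$.
   Context: Dynamic Elephant Random Walk (DERW). Let $(\mathcal{X},\mathscr{A},\mu)$ be a probability space and $T:\mathcal{X}\to\mathcal{X}$ a measurable $\mu$-preserving map ($\mu(T^{-1}A)=\mu(A)$ for all $A\in\mathscr{A}$); $T^n$ denotes the $n$-fold iterate. Let $f:\mathcal{X}\to[0,1]$ be $\mathscr{A}$-measurable. Let $p,q\in[0,1]$, let $g:R\subset\mathbb{R}\times\mathbb{N}\to[0,1]$ be a function and fix $\alpha\in\mathbb{R}$ with $(\alpha,n)\in R$ for all $n\ge1$; write $\alpha_n:=g(\alpha,n)\in[0,1]$. For $x\in\mathcal{X}$, the DERW under the probability $\mathbb{P}_x$ (expectation $\mathbb{E}_x$) is the process $S_0=0$, $S_n=\sum_{i=1}^n X_i$, with $\{-1,1\}$-valued increments such that $\mathbb{P}_x[X_1=1]=\alpha_1 q+(1-\alpha_1)f(Tx)$ and, for $n\ge1$, $\eta\in\{-1,1\}$,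 with $\mathscr{F}_n=\sigma(X_1,\dots,X_n)$, $$\mathbb{P}_x[X_{n+1}=\eta\mid\mathscr{F}_n]=\alpha_{n+1}\,\frac{1}{2n}\sum_{k=1}^{n}\bigl(1+(2p-1)X_k\eta\bigr)+(1-\alpha_{n+1})\,d_{n+1}(\eta),$$ where $d_m(1)=f(T^m x)$ and $d_m(-1)=1-f(T^m x)$. *)

theory Defs
  imports "HOL-Probability.Probability"
begin

text \<open>The \<open>\<sigma>\<close>-algebra of the (strictly) \<open>T\<close>-invariant sets, packaged as a measure so that it
  can be passed to \<^const>\<open>real_cond_exp\<close>.\<close>

definition invariant_algebra :: "'a measure \<Rightarrow> ('a \<Rightarrow> 'a) \<Rightarrow> 'a measure" where
  "invariant_algebra M T = sigma (space M) {A \<in> sets M. T -` A \<inter> space M = A}"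

lemma space_invariant_algebra [simp]: "space (invariant_algebra M T) = space M"
  by (simp add: invariant_algebra_def space_measure_of_conv)

lemma sets_invariant_algebra:
  assumes "T \<in> measurable M M"
  shows "sets (invariant_algebra M T) = {A \<in> sets M. T -` A \<inter> space M = A}"
proof -
  have "sigma_algebra (space M) {A \<in> sets M. T -` A \<inter> space M = A}" (is "sigma_algebra _ ?I")
    unfolding sigma_algebra_iff2
  proof (intro conjI ballI allI impI)
    show "?I \<subseteq> Pow (space M)"
      using sets.sets_into_space by auto
    show "{} \<in> ?I"
      by simp
    show "space M - A \<in> ?I" if "A \<in> ?I" for A
    proof -
      have "T -` (space M - A) \<inter> space M = space M - (T -` A \<inter> space M)"
        using measurable_space[OF assms] by blast
      with that show ?thesis by auto
    qed
    show "(\<Union>i. A i) \<in> ?I" if "range A \<subseteq> ?I" for A :: "nat \<Rightarrow> 'a set"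
    proof -
      have "T -` (\<Union>i. A i) \<inter> space M = (\<Union>i. T -` A i \<inter> space M)"
        by blast
      also have "\<dots> = (\<Union>i. A i)"
        using that by (intro SUP_cong) auto
      finally have "T -` (\<Union>i. A i) \<inter> space M = (\<Union>i. A i)" .
      moreover have "(\<Union>i. A i) \<in> sets M"
        using that by (intro sets.countable_UN) auto
      ultimately show ?thesis by simp
    qed
  qed
  moreover have "{A \<in> sets M. T -` A \<inter> space M = A} \<subseteq> Pow (space M)"
    using sets.sets_into_space by auto
  ultimately show ?thesis
    by (simp add: invariant_algebra_def sigma_algebra.sigma_sets_eq)
qed

lemma subalgebra_invariant_algebra:
  "T \<in> measurable M M \<Longrightarrow> subalgebra M (invariant_algebra M T)"
  by (auto simp: subalgebra_def sets_invariant_algebra)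

text \<open>The \<open>\<sigma>\<close>-algebra generated by \<open>X 1, \<dots>, X n\<close>.\<close>

definition history :: "'w measure \<Rightarrow> (nat \<Rightarrow> 'w \<Rightarrow> real) \<Rightarrow> nat \<Rightarrow> 'w measure" where
  "history M X n =
     sigma (space M) (\<Union>i\<in>{1..n}. {X i -` B \<inter> space M | B. B \<in> sets borel})"

lemma subalgebra_history:
  assumes "\<And>n. n \<ge> 1 \<Longrightarrow> X n \<in> borel_measurable M"
  shows "subalgebra M (history M X n)"
proof -
  have "(\<Union>i\<in>{1..n}. {X i -` B \<inter> space M | B. B \<in> sets borel}) \<subseteq> sets M"
    using assms by (auto intro: measurable_sets)
  moreover from this have "(\<Union>i\<in>{1..n}. {X i -` B \<inter> space M | B. B \<in> sets borel}) \<subseteq> Pow (space M)"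
    using sets.space_closed by (rule subset_trans)
  ultimately show ?thesis
    by (simp add: subalgebra_def history_def sets.sigma_sets_subset)
qed

text \<open>The step law of the random environment: \<open>env_step f T x m \<eta>\<close> is the probability \<open>d\<^sub>m(\<eta>)\<close>;
  only the values \<open>\<eta> = 1\<close> and \<open>\<eta> = -1\<close> are meaningful.\<close>

definition env_step :: "('a \<Rightarrow> real) \<Rightarrow> ('a \<Rightarrow> 'a) \<Rightarrow> 'a \<Rightarrow> nat \<Rightarrow> real \<Rightarrow> real" where
  "env_step f T x m \<eta> = (if \<eta> = 1 then f ((T ^^ m) x) else 1 - f ((T ^^ m) x))"

text \<open>\<open>M\<close> plays the role of \<open>P\<^sub>x\<close> and \<open>X n\<close>, \<open>n \<ge> 1\<close>, are the increments; \<open>X 0\<close> and \<open>a 0\<close> are irrelevant.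
  Conditional probabilities are conditional expectations of indicator functions.\<close>

locale DERW_increments = prob_space M
  for M :: "'w measure"
    and X :: "nat \<Rightarrow> 'w \<Rightarrow> real"
    and f :: "'a \<Rightarrow> real"
    and T :: "'a \<Rightarrow> 'a"
    and a :: "nat \<Rightarrow> real"
    and p q :: real
    and x :: 'a +
  assumes X_measurable: "\<And>n. n \<ge> 1 \<Longrightarrow> X n \<in> borel_measurable M"
    and X_values: "\<And>n \<omega>. n \<ge> 1 \<Longrightarrow> \<omega> \<in> space M \<Longrightarrow> X n \<omega> \<in> {-1, 1}"
    and first_step:
      "measure M {\<omega> \<in> space M. X 1 \<omega> = 1} = a 1 * q + (1 - a 1) * f (T x)"
    and next_step: "\<And>n \<eta>. n \<ge> 1 \<Longrightarrow> \<eta> \<in> {-1, 1} \<Longrightarrow>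
      AE \<omega> in M.
        real_cond_exp M (history M X n) (indicator {\<omega> \<in> space M. X (n + 1) \<omega> = \<eta>}) \<omega> =
          a (n + 1) * (1 / (2 * real n) * (\<Sum>k = 1..n. 1 + (2 * p - 1) * X k \<omega> * \<eta>))
          + (1 - a (n + 1)) * env_step f T x (n + 1) \<eta>"

definition walk :: "(nat \<Rightarrow> 'w \<Rightarrow> real) \<Rightarrow> nat \<Rightarrow> 'w \<Rightarrow> real" where
  "walk X n \<omega> = (\<Sum>i = 1..n. X i \<omega>)"

end

theory Submission
  imports Defs "HOL-Library.Discrete_Functions"
begin

text \<open>For \<open>p = 1/2\<close> the memory term is the constant \<open>1/2\<close>, so the conditional mean of each increment
  \<open>X\<^sub>i\<close>, \<open>i \<ge> 2\<close>, is the deterministic number \<open>c\<^sub>i = (1 - \<alpha>\<^sub>i) (2 f (T\<^sup>i x) - 1)\<close>. Hence the variables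
  \<open>X\<^sub>i - c\<^sub>i\<close> are bounded and pairwise orthogonal, and their averages vanish almost surely: along the
  squares the second moments are summable, and boundedness fills the gaps. The averages of the \<open>c\<^sub>i\<close>
  converge for almost every \<open>x\<close> by Birkhoff's ergodic theorem, which is obtained from a maximal
  inequality on the invariant set where the Birkhoff sums of \<open>f - E[f | I] - \<epsilon>\<close> are unbounded above.\<close>

section \<open>A strong law for orthogonal bounded variables\<close>

text \<open>Sum and integral of nonnegative functions commute, so the series of the
  \<open>Z n\<close> has finite integral. It is therefore finite almost everywhere, and there its
  terms vanish.\<close>

lemma AE_tendsto_zero_if_summable_integral:
  fixes Z :: "nat \<Rightarrow> 'a \<Rightarrow> real"
  assumes int: "\<And>n. integrable M (Z n)"
    and nonneg: "\<And>n x. 0 \<le> Z n x"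
    and summable: "summable (\<lambda>n. \<integral>x. Z n x \<partial>M)"
  shows "AE x in M. (\<lambda>n. Z n x) \<longlonglongrightarrow> 0"
proof -
  have [measurable]: "\<And>n. Z n \<in> borel_measurable M"
    using int by blast
  have "(\<integral>\<^sup>+x. (\<Sum>n. ennreal (Z n x)) \<partial>M) = (\<Sum>n. \<integral>\<^sup>+x. ennreal (Z n x) \<partial>M)"
    by (rule nn_integral_suminf) simp
  also have "\<dots> = (\<Sum>n. ennreal (\<integral>x. Z n x \<partial>M))"
    by (intro suminf_cong nn_integral_eq_integral int AE_I2 nonneg)
  also have "\<dots> = ennreal (\<Sum>n. \<integral>x. Z n x \<partial>M)"
    by (intro suminf_ennreal2 integral_nonneg_AE AE_I2 nonneg summable)
  finally have "(\<integral>\<^sup>+x. (\<Sum>n. ennreal (Z n x)) \<partial>M) \<noteq> \<infinity>"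
    by simp
  then have "AE x in M. (\<Sum>n. ennreal (Z n x)) \<noteq> \<infinity>"
    by (intro nn_integral_PInf_AE) simp_all
  then show ?thesis
    by eventually_elim (auto intro!: summable_LIMSEQ_zero summable_suminf_not_top nonneg)
qed

text \<open>From m^2 to below (m+1)^2 there are at most 2m further indices, so the partial sum of a
  bounded sequence changes by at most 2mB, which vanishes after division by m^2.\<close>

lemma tendsto_averages_if_tendsto_square_averages:
  fixes u :: "nat \<Rightarrow> real"
  assumes bound: "\<And>n. n \<ge> 1 \<Longrightarrow> \<bar>u n\<bar> \<le> B"
    and squares: "(\<lambda>m. (\<Sum>i = 1..m\<^sup>2. u i) / real (m\<^sup>2)) \<longlonglongrightarrow> 0"
  shows "(\<lambda>n. (\<Sum>i = 1..n. u i) / real n) \<longlonglongrightarrow> 0"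
proof -
  define S where "S n = (\<Sum>i = 1..n. u i)" for n
  have B: "0 \<le> B"
    using bound[of 1] by simp
  have sqrt_lim: "filterlim floor_sqrt at_top sequentially"
    unfolding filterlim_at_top
  proof
    fix Z
    show "\<forall>\<^sub>F n in sequentially. Z \<le> floor_sqrt n"
      using eventually_ge_at_top[of "Z\<^sup>2"]
      by eventually_elim (metis floor_sqrt_inverse_power2 mono_floor_sqrt')
  qed
  have le: "norm (S n / real n) \<le> \<bar>S ((floor_sqrt n)\<^sup>2) / real ((floor_sqrt n)\<^sup>2)\<bar> + 2 * B / real (floor_sqrt n)"
    if "n \<ge> 1" for n
  proof -
    define m where "m = floor_sqrt n"
    have m: "m\<^sup>2 \<le> n" "n < (Suc m)\<^sup>2"
      unfolding m_def using Suc_floor_sqrt_power2_gt by auto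
    have m1: "m \<ge> 1"
      using m(2) that by (cases m) auto
    have "S n = S (m\<^sup>2) + (\<Sum>i = m\<^sup>2 + 1..n. u i)"
      unfolding S_def using m(1) by (metis le_add2 sum.ub_add_nat le_add_diff_inverse)
    moreover have "\<bar>\<Sum>i = m\<^sup>2 + 1..n. u i\<bar> \<le> (\<Sum>i = m\<^sup>2 + 1..n. B)"
      by (rule order_trans[OF sum_abs]) (intro sum_mono bound, auto)
    moreover have "(\<Sum>i = m\<^sup>2 + 1..n. B) \<le> real (2 * m) * B"
    proof -
      have "n - m\<^sup>2 \<le> 2 * m"
        using m by (simp add: power2_eq_square)
      then show ?thesis
        using B by (simp add: mult_right_mono del: of_nat_mult)
    qed
    ultimately have "\<bar>S n\<bar> \<le> \<bar>S (m\<^sup>2)\<bar> + 2 * real m * B"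
      by simp
    then have "\<bar>S n\<bar> / real n \<le> (\<bar>S (m\<^sup>2)\<bar> + 2 * real m * B) / real (m\<^sup>2)"
      using m m1 B by (intro frac_le) (auto simp del: of_nat_power)
    also have "\<dots> = \<bar>S (m\<^sup>2) / real (m\<^sup>2)\<bar> + 2 * B / real m"
      using m1 by (simp add: field_simps power2_eq_square)
    finally show ?thesis
      by (simp add: m_def)
  qed
  have "(\<lambda>m. \<bar>S (m\<^sup>2) / real (m\<^sup>2)\<bar> + 2 * B / real m) \<longlonglongrightarrow> \<bar>0\<bar> + 0"
    using squares unfolding S_def[symmetric]
    by (intro tendsto_add tendsto_rabs lim_const_over_n)
  then have "(\<lambda>m. \<bar>S (m\<^sup>2) / real (m\<^sup>2)\<bar> + 2 * B / real m) \<longlonglongrightarrow> 0"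
    by simp
  from filterlim_compose[OF this sqrt_lim]
  have "(\<lambda>n. S n / real n) \<longlonglongrightarrow> 0"
    by (rule Lim_null_comparison[rotated]) (use le in \<open>auto simp: eventually_at_top_linorder\<close>)
  then show ?thesis
    by (simp add: S_def)
qed

text \<open>Orthogonality kills the cross terms, so E[S_n^2] \<le> n B^2. Along the squares the
  averages S_(m^2)/m^2 have second moment at most B^2/m^2, which is summable.\<close>

lemma (in prob_space) orthogonal_strong_law:
  fixes Y :: "nat \<Rightarrow> 'a \<Rightarrow> real"
  assumes meas: "\<And>n. n \<ge> 1 \<Longrightarrow> Y n \<in> borel_measurable M"
    and bound: "\<And>n \<omega>. n \<ge> 1 \<Longrightarrow> \<omega> \<in> space M \<Longrightarrow> \<bar>Y n \<omega>\<bar> \<le> B"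
    and orth: "\<And>i j. 1 \<le> i \<Longrightarrow> i < j \<Longrightarrow> expectation (\<lambda>\<omega>. Y i \<omega> * Y j \<omega>) = 0"
  shows "AE \<omega> in M. (\<lambda>n. (\<Sum>i = 1..n. Y i \<omega>) / real n) \<longlonglongrightarrow> 0"
proof -
  define S where "S n \<omega> = (\<Sum>i = 1..n. Y i \<omega>)" for n \<omega>
  have S_meas [measurable]: "S n \<in> borel_measurable M" for n
    unfolding S_def using meas by (intro borel_measurable_sum) auto
  have S_bound: "\<bar>S n \<omega>\<bar> \<le> real n * B" if "\<omega> \<in> space M" for n \<omega>
  proof -
    have "\<bar>S n \<omega>\<bar> \<le> (\<Sum>i = 1..n. B)"
      unfolding S_def by (rule order_trans[OF sum_abs]) (intro sum_mono bound that, auto)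
    then show ?thesis by simp
  qed
  have int_bdd: "integrable M h" if "h \<in> borel_measurable M" "\<And>\<omega>. \<omega> \<in> space M \<Longrightarrow> \<bar>h \<omega>\<bar> \<le> C"
    for h :: "'a \<Rightarrow> real" and C
    using that by (intro integrable_const_bound[where B = C]) auto
  have int_YY: "integrable M (\<lambda>\<omega>. Y i \<omega> * Y j \<omega>)" if "i \<ge> 1" "j \<ge> 1" for i j
    using meas[OF that(1)] meas[OF that(2)] that
    by (intro int_bdd[of _ "B * B"]) (auto simp: abs_mult intro!: mult_mono' bound)
  have int_S: "integrable M (\<lambda>\<omega>. (S n \<omega>)\<^sup>2)" for n
    by (intro int_bdd[of _ "(real n * B)\<^sup>2"])
      (auto simp: abs_le_square_iff[symmetric] intro: order_trans[OF S_bound abs_ge_self])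
  have second_moment: "expectation (\<lambda>\<omega>. (S n \<omega>)\<^sup>2) \<le> real n * B\<^sup>2" for n
  proof (induction n)
    case 0
    show ?case by (simp add: S_def)
  next
    case (Suc n)
    \<comment> \<open>The cross term stays a sum of products so that \<open>orth\<close> applies to
      each summand.\<close>
    have eq: "(S (Suc n) \<omega>)\<^sup>2 =
        (S n \<omega>)\<^sup>2 + 2 * (\<Sum>i = 1..n. Y i \<omega> * Y (Suc n) \<omega>) + Y (Suc n) \<omega> * Y (Suc n) \<omega>" for \<omega>
      by (simp add: S_def power2_eq_square algebra_simps sum_distrib_left)
    have "expectation (\<lambda>\<omega>. \<Sum>i = 1..n. Y i \<omega> * Y (Suc n) \<omega>) = 0"
      by (subst Bochner_Integration.integral_sum) (auto intro!: int_YY sum.neutral orth)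
    then have "expectation (\<lambda>\<omega>. (S (Suc n) \<omega>)\<^sup>2) =
        expectation (\<lambda>\<omega>. (S n \<omega>)\<^sup>2) + expectation (\<lambda>\<omega>. Y (Suc n) \<omega> * Y (Suc n) \<omega>)"
      unfolding eq using int_S int_YY
      by (subst Bochner_Integration.integral_add Bochner_Integration.integral_mult_right,
          auto intro!: Bochner_Integration.integrable_add integrable_mult_right
            Bochner_Integration.integrable_sum)+
    moreover have "expectation (\<lambda>\<omega>. Y (Suc n) \<omega> * Y (Suc n) \<omega>) \<le> B\<^sup>2"
    proof (rule integral_le_const)
      show "AE \<omega> in M. Y (Suc n) \<omega> * Y (Suc n) \<omega> \<le> B\<^sup>2"
        using bound[of "Suc n"]
        by (intro AE_I2) (metis abs_le_square_iff abs_ge_self order_trans power2_eq_square le_add1 plus_1_eq_Suc)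
    qed (auto intro: int_YY)
    ultimately show ?case
      using Suc.IH by (simp add: algebra_simps)
  qed
  define Z where "Z m \<omega> = (S (m\<^sup>2) \<omega> / real (m\<^sup>2))\<^sup>2" for m \<omega>
  have EZ: "expectation (Z m) \<le> B\<^sup>2 * inverse (real m ^ 2)" for m
  \<comment> \<open>For \<open>m = 0\<close> both sides are 0, since division by zero yields 0; the
    closing \<open>simp\<close> settles that case.\<close>
  proof (cases "m = 0")
    case False
    have "expectation (Z m) = expectation (\<lambda>\<omega>. (S (m\<^sup>2) \<omega>)\<^sup>2) / (real (m\<^sup>2))\<^sup>2"
      unfolding Z_def[abs_def] power_divide by (rule integral_divide_zero)
    also have "\<dots> \<le> (real (m\<^sup>2) * B\<^sup>2) / (real (m\<^sup>2))\<^sup>2"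
      by (intro divide_right_mono second_moment) simp
    also have "\<dots> = B\<^sup>2 * inverse (real m ^ 2)"
      using False by (simp add: field_simps power2_eq_square)
    finally show ?thesis .
  qed (simp add: Z_def[abs_def])
  have "AE \<omega> in M. (\<lambda>m. Z m \<omega>) \<longlonglongrightarrow> 0"
  proof (rule AE_tendsto_zero_if_summable_integral)
    show "integrable M (Z m)" for m
      unfolding Z_def power_divide by (intro integrable_divide int_S)
    show "0 \<le> Z m \<omega>" for m \<omega>
      by (simp add: Z_def)
    have "summable (\<lambda>m. B\<^sup>2 * inverse (real m ^ 2))"
      by (intro summable_mult inverse_power_summable) simp
    then show "summable (\<lambda>m. expectation (Z m))"
      by (rule summable_comparison_test'[where N = 0])
        (use EZ in \<open>auto simp: Z_def integral_nonneg_AE\<close>)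
  qed
  with AE_space show ?thesis
  proof eventually_elim
    case (elim \<omega>)
    from elim(2) have "(\<lambda>m. sqrt (Z m \<omega>)) \<longlonglongrightarrow> sqrt 0"
      by (intro tendsto_real_sqrt)
    then have "(\<lambda>m. S (m\<^sup>2) \<omega> / real (m\<^sup>2)) \<longlonglongrightarrow> 0"
      by (simp only: Z_def real_sqrt_abs real_sqrt_zero tendsto_rabs_zero_iff)
    then show "(\<lambda>n. (\<Sum>i = 1..n. Y i \<omega>) / real n) \<longlonglongrightarrow> 0"
      using elim(1) unfolding S_def
      by (intro tendsto_averages_if_tendsto_square_averages[where B = B] bound)
  qed
qed

section \<open>Birkhoff's ergodic theorem\<close>

text \<open>The maximum of the Birkhoff sums of \<open>g\<close> of lengths 0, ..., n, where the
  empty sum contributes 0. Splitting off the first orbit point relates it directly to the value at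
  \<open>T x\<close>.\<close>

primrec max_birkhoff :: "('a \<Rightarrow> 'a) \<Rightarrow> ('a \<Rightarrow> real) \<Rightarrow> nat \<Rightarrow> 'a \<Rightarrow> real" where
  "max_birkhoff T g 0 x = 0"
| "max_birkhoff T g (Suc n) x = max 0 (g x + max_birkhoff T g n (T x))"

lemma max_birkhoff_nonneg: "0 \<le> max_birkhoff T g n x"
  by (cases n) auto

lemma max_birkhoff_le_Suc: "max_birkhoff T g n x \<le> max_birkhoff T g (Suc n) x"
proof (induction n arbitrary: x)
  case (Suc n)
  then show ?case
    using max.mono[OF order_refl add_left_mono[OF Suc.IH[of "T x"]]] by simp
qed simp

lemma birkhoff_sum_le_max_birkhoff: "(\<Sum>k<n. g ((T ^^ k) x)) \<le> max_birkhoff T g n x"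
proof (induction n arbitrary: x)
  case (Suc n)
  have "(\<Sum>k<Suc n. g ((T ^^ k) x)) = g x + (\<Sum>k<n. g ((T ^^ k) (T x)))"
    by (subst sum.lessThan_Suc_shift) (simp add: funpow_swap1)
  also have "\<dots> \<le> g x + max_birkhoff T g n (T x)"
    using Suc.IH by simp
  finally show ?case by simp
qed simp

lemma borel_measurable_max_birkhoff [measurable]:
  assumes [measurable]: "T \<in> measurable M M" "g \<in> borel_measurable M"
  shows "max_birkhoff T g n \<in> borel_measurable M"
  by (induction n) (simp_all add: measurable_compose[OF assms(1)])

lemma integrable_max_birkhoff:
  assumes T: "T \<in> measurable M M" "distr M M T = M" and g: "integrable M g"
  shows "integrable M (max_birkhoff T g n)"
proof (induction n)
  case (Suc n)
  then have "integrable M (\<lambda>x. max_birkhoff T g n (T x))"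
    using T integrable_distr[OF T(1)] by metis
  then show ?case
    using g by simp
qed simp

text \<open>A form of the maximal ergodic theorem: where \<open>max_birkhoff\<close> tends to infinity, the increment
  \<open>max_birkhoff T g (Suc n) - max_birkhoff T g n \<circ> T = max g (- max_birkhoff T g n \<circ> T)\<close> tends to \<open>g\<close>,
  while by invariance its integral over \<open>A\<close> is nonnegative.\<close>

lemma maximal_ergodic:
  assumes T: "T \<in> measurable M M" "distr M M T = M" and g: "integrable M g"
    and A: "A \<in> sets M" "T -` A \<inter> space M = A"
    and unbounded: "\<And>x C. x \<in> A \<Longrightarrow> \<exists>n. C < max_birkhoff T g n x"
  shows "0 \<le> (\<integral>x. indicator A x * g x \<partial>M)"
proof -
  let ?m = "max_birkhoff T g"
  note [measurable] = T(1) A(1) borel_measurable_integrable[OF g]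
  have int_A: "integrable M (\<lambda>x. indicator A x * h x)" if "integrable M h" for h :: "'a \<Rightarrow> real"
    using integrable_mult_indicator[OF A(1) that] by simp
  have ind_T: "indicator A (T x) = (indicator A x :: real)" if "x \<in> space M" for x
    using A(2) that by (auto simp: indicator_def)
  define d where "d n x = indicator A x * (?m (Suc n) x - ?m n (T x))" for n x
  have "0 \<le> (\<integral>x. d n x \<partial>M)" for n
  proof -
    \<comment> \<open>Writing \<open>indicator A (T x)\<close> for \<open>indicator A x\<close>
      makes the integrand a function of \<open>T x\<close>, so the integral can be moved to the
      image measure, which is \<open>M\<close> again.\<close>
    have "(\<integral>x. indicator A x * ?m n (T x) \<partial>M) = (\<integral>x. indicator A (T x) * ?m n (T x) \<partial>M)"
      by (intro Bochner_Integration.integral_cong) (auto simp: ind_T)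
    also have "\<dots> = (\<integral>x. indicator A x * ?m n x \<partial>distr M M T)"
      by (subst integral_distr) simp_all
    finally have eq: "(\<integral>x. indicator A x * ?m n (T x) \<partial>M) = (\<integral>x. indicator A x * ?m n x \<partial>M)"
      by (simp add: T(2))
    have "integrable M (\<lambda>x. ?m n (T x))"
      using T integrable_distr[OF T(1)] integrable_max_birkhoff[OF T g] by metis
    then have "(\<integral>x. d n x \<partial>M) =
        (\<integral>x. indicator A x * ?m (Suc n) x \<partial>M) - (\<integral>x. indicator A x * ?m n (T x) \<partial>M)"
      unfolding d_def right_diff_distrib
      by (intro Bochner_Integration.integral_diff int_A integrable_max_birkhoff T g)
    moreover have "(\<integral>x. indicator A x * ?m n x \<partial>M) \<le> (\<integral>x. indicator A x * ?m (Suc n) x \<partial>M)"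
      by (intro integral_mono int_A integrable_max_birkhoff T g mult_left_mono max_birkhoff_le_Suc) simp
    ultimately show ?thesis
      using eq by simp
  qed
  moreover have "(\<lambda>n. \<integral>x. d n x \<partial>M) \<longlonglongrightarrow> (\<integral>x. indicator A x * g x \<partial>M)"
  proof (rule integral_dominated_convergence[where w = "\<lambda>x. \<bar>g x\<bar>"])
    show "AE x in M. (\<lambda>n. d n x) \<longlonglongrightarrow> indicator A x * g x"
    proof (rule AE_I2)
      fix x assume x: "x \<in> space M"
      show "(\<lambda>n. d n x) \<longlonglongrightarrow> indicator A x * g x"
      proof (cases "x \<in> A")
        case True
        then have "T x \<in> A"
          using A(2) by blast
        \<comment> \<open>Once \<open>?m n (T x)\<close> exceeds \<open>- g x\<close>, the outer
          maximum in the recursion is \<open>g x + ?m n (T x)\<close>, so the difference is exactly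
          \<open>g x\<close>.\<close>
        from unbounded[OF this] obtain N where N: "- g x < ?m N (T x)"
          by blast
        have "d n x = g x" if "n \<ge> N" for n
          using N lift_Suc_mono_le[of "\<lambda>n. ?m n (T x)", OF max_birkhoff_le_Suc that] True
          by (simp add: d_def)
        then show ?thesis
          using True by (intro tendsto_eventually) (auto simp: eventually_at_top_linorder)
      qed (simp add: d_def)
    qed
    \<comment> \<open>On \<open>A\<close>, \<open>d n x\<close> is the maximum of \<open>g x\<close>
      and a nonpositive number: it equals \<open>g x\<close> if \<open>g x \<ge> 0\<close> and lies
      between \<open>g x\<close> and 0 otherwise.\<close>
    show "AE x in M. norm (d n x) \<le> \<bar>g x\<bar>" for n
      using max_birkhoff_nonneg[of T g n] by (intro AE_I2) (auto simp: d_def indicator_def max_def not_le)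
  qed (auto simp: d_def[abs_def] g)
  ultimately show ?thesis
    by (intro LIMSEQ_le_const) auto
qed

text \<open>The level set of \<open>h\<close> through \<open>x\<close> lies in the invariant
  algebra, so it equals its own preimage under \<open>T\<close>; containing \<open>x\<close>, it
  contains \<open>T x\<close>.\<close>

lemma invariant_algebra_measurable_comp:
  fixes h :: "'a \<Rightarrow> real"
  assumes T: "T \<in> measurable M M" and h: "h \<in> borel_measurable (invariant_algebra M T)"
    and x: "x \<in> space M"
  shows "h (T x) = h x"
proof -
  have "h -` {h x} \<inter> space M \<in> sets (invariant_algebra M T)"
    using measurable_sets[OF h, of "{h x}"] by simp
  then have "T -` (h -` {h x} \<inter> space M) \<inter> space M = h -` {h x} \<inter> space M"
    by (simp add: sets_invariant_algebra[OF T])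
  then show ?thesis
    using x by blast
qed

lemma funpow_in_space: "T \<in> measurable M M \<Longrightarrow> x \<in> space M \<Longrightarrow> (T ^^ k) x \<in> space M"
  by (induction k) (auto dest: measurable_space)

text \<open>On the invariant set where the maxima for \<open>f - E - e\<close> are unbounded, the
  integral of this function is -e times the measure of the set. The maximal inequality makes it
  nonnegative, so the set is null; off it, a bound on the maxima serves as \<open>C\<close>.\<close>

lemma (in finite_measure) birkhoff_sum_upper_bound:
  assumes T: "T \<in> measurable M M" "distr M M T = M" and f: "integrable M f" and e: "0 < e"
  shows "AE x in M. \<exists>C. \<forall>n.
    (\<Sum>k<n. f ((T ^^ k) x)) \<le> real n * (real_cond_exp M (invariant_algebra M T) f x + e) + C"
proof -
  interpret I: finite_measure_subalgebra M "invariant_algebra M T"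
    by unfold_locales (rule subalgebra_invariant_algebra[OF T(1)])
  define E where "E = real_cond_exp M (invariant_algebra M T) f"
  have E: "integrable M E"
    unfolding E_def by (rule I.real_cond_exp_int[OF f])
  have E_T: "E (T x) = E x" if "x \<in> space M" for x
    unfolding E_def by (rule invariant_algebra_measurable_comp[OF T(1) _ that]) simp
  define g where "g x = f x - E x - e" for x
  have g: "integrable M g"
    unfolding g_def using f E by simp
  note [measurable] = T(1) borel_measurable_integrable[OF g]
  let ?m = "max_birkhoff T g"
  \<comment> \<open>Natural bounds keep the definition within countable operations, hence
    measurable; the Archimedean property recovers real bounds.\<close>
  define A where "A = {x \<in> space M. \<forall>C::nat. \<exists>n. real C < ?m n x}"
  have A_sets [measurable]: "A \<in> sets M"
    unfolding A_def by measurable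
  have A_unbounded: "\<exists>n. C < ?m n x" if "x \<in> A" for x C
    using that reals_Archimedean2[of C] unfolding A_def by (blast intro: less_trans)
  have A_inv: "T -` A \<inter> space M = A"
  proof (intro equalityI subsetI)
    fix x assume x: "x \<in> T -` A \<inter> space M"
    have "\<exists>n. real C < ?m n x" for C
    proof -
      obtain n where "real C - g x < ?m n (T x)"
        using A_unbounded x by blast
      then have "real C < ?m (Suc n) x"
        by simp
      then show ?thesis ..
    qed
    then show "x \<in> A"
      using x by (auto simp: A_def)
  next
    fix x assume x: "x \<in> A"
    have "\<exists>n. real C < ?m n (T x)" for C
    proof -
      \<comment> \<open>The 0 excludes \<open>n = 0\<close> and forces the second argument of the
        outer maximum in the recursion; \<open>g x\<close> then cancels.\<close>
      obtain n where n: "max 0 (g x + real C) < ?m n x"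
        using A_unbounded[OF x] by blast
      then obtain k where "n = Suc k"
        by (cases n) auto
      with n have "real C < ?m k (T x)"
        by auto
      then show ?thesis ..
    qed
    then show "x \<in> T -` A \<inter> space M"
      using x measurable_space[OF T(1)] by (auto simp: A_def)
  qed
  have "0 \<le> (\<integral>x. indicator A x * g x \<partial>M)"
    by (rule maximal_ergodic[OF T g A_sets A_inv A_unbounded])
  also have "(\<integral>x. indicator A x * g x \<partial>M) = - (e * measure M A)"
  proof -
    \<comment> \<open>Over a set of the invariant algebra, \<open>f\<close> and \<open>E\<close>
      have equal integrals, so only \<open>- e\<close> survives.\<close>
    have "A \<in> sets (invariant_algebra M T)"
      using A_inv by (simp add: sets_invariant_algebra[OF T(1)])
    from I.real_cond_exp_intA[OF f this]
    have eq: "(\<integral>x. indicator A x * f x \<partial>M) = (\<integral>x. indicator A x * E x \<partial>M)"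
      by (simp add: set_lebesgue_integral_def E_def)
    have int_A: "integrable M (\<lambda>x. indicator A x * h x)" if "integrable M h" for h :: "'a \<Rightarrow> real"
      using integrable_mult_indicator[OF A_sets that] by simp
    have "(\<integral>x. indicator A x * g x \<partial>M) =
        (\<integral>x. indicator A x * f x \<partial>M) - (\<integral>x. indicator A x * E x \<partial>M) - (\<integral>x. indicator A x * e \<partial>M)"
      unfolding g_def right_diff_distrib using f E
      by (subst Bochner_Integration.integral_diff;
          (intro Bochner_Integration.integrable_diff int_A)?; simp)+
    then show ?thesis
      using eq by simp
  qed
  finally have "measure M A = 0"
    using e by (simp add: mult_le_0_iff measure_le_0_iff)
  then have "AE x in M. x \<notin> A"
    by (intro AE_not_in) (simp add: null_sets_def emeasure_eq_measure)
  with AE_space show ?thesis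
  proof eventually_elim
    case x: (elim x)
    then obtain C where C: "\<And>n. ?m n x \<le> C"
      by (auto simp: A_def not_less)
    have E_funpow: "E ((T ^^ k) x) = E x" for k
      by (induction k) (simp_all add: E_T funpow_in_space[OF T(1) x(1)])
    have "(\<Sum>k<n. f ((T ^^ k) x)) \<le> real n * (E x + e) + C" for n
    proof -
      have "(\<Sum>k<n. g ((T ^^ k) x)) = (\<Sum>k<n. f ((T ^^ k) x)) - real n * (E x + e)"
        by (simp add: g_def E_funpow sum_subtractf algebra_simps)
      then show ?thesis
        using birkhoff_sum_le_max_birkhoff[of g T x n] C[of n] by linarith
    qed
    then show "\<exists>C. \<forall>n. (\<Sum>k<n. f ((T ^^ k) x))
        \<le> real n * (real_cond_exp M (invariant_algebra M T) f x + e) + C"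
      unfolding E_def by blast
  qed
qed

text \<open>The constant \<open>C\<close> disappears after division by \<open>n\<close>. The slacks
  form a countable family so that bounds holding almost everywhere for each slack hold for all of
  them at once.\<close>

lemma eventually_average_less:
  fixes s :: "nat \<Rightarrow> real"
  assumes bound: "\<And>k. \<exists>C. \<forall>n. s n \<le> real n * (L + 1 / real (Suc k)) + C" and "L < a"
  shows "\<forall>\<^sub>F n in sequentially. s n / real n < a"
proof -
  obtain k where k: "1 / real (Suc k) < a - L"
    using \<open>L < a\<close> reals_Archimedean[of "a - L"] by (auto simp: inverse_eq_divide)
  obtain C where C: "\<And>n. s n \<le> real n * (L + 1 / real (Suc k)) + C"
    using bound by blast
  have "(\<lambda>n. L + 1 / real (Suc k) + C / real n) \<longlonglongrightarrow> L + 1 / real (Suc k) + 0"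
    by (intro tendsto_add tendsto_const lim_const_over_n)
  then have "\<forall>\<^sub>F n in sequentially. L + 1 / real (Suc k) + C / real n < a"
    using k by (intro order_tendstoD(2)) auto
  then show ?thesis
    using eventually_gt_at_top[of 0]
  proof eventually_elim
    case (elim n)
    have "s n / real n \<le> (real n * (L + 1 / real (Suc k)) + C) / real n"
      by (intro divide_right_mono C) simp
    also have "\<dots> = L + 1 / real (Suc k) + C / real n"
      using elim by (simp add: add_divide_distrib)
    finally have "s n / real n \<le> L + 1 / real (Suc k) + C / real n" .
    with elim show ?case by simp
  qed
qed

text \<open>The upper bound for \<open>f\<close> controls the upper limit; the one for
  \<open>- f\<close>, whose conditional expectation is the negative almost everywhere, controls the
  lower limit.\<close>

theorem (in finite_measure) birkhoff_ergodic:
  assumes T: "T \<in> measurable M M" "distr M M T = M" and f: "integrable M f"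
  shows "AE x in M. (\<lambda>n. (\<Sum>k<n. f ((T ^^ k) x)) / real n)
    \<longlonglongrightarrow> real_cond_exp M (invariant_algebra M T) f x"
proof -
  interpret I: finite_measure_subalgebra M "invariant_algebra M T"
    by unfold_locales (rule subalgebra_invariant_algebra[OF T(1)])
  let ?E = "real_cond_exp M (invariant_algebra M T)"
  have "AE x in M. \<forall>j. \<exists>C. \<forall>n. (\<Sum>k<n. f ((T ^^ k) x)) \<le> real n * (?E f x + 1 / real (Suc j)) + C"
    unfolding AE_all_countable by (intro allI birkhoff_sum_upper_bound T f) simp
  moreover have "AE x in M. \<forall>j. \<exists>C. \<forall>n.
      (\<Sum>k<n. - f ((T ^^ k) x)) \<le> real n * (?E (\<lambda>x. - f x) x + 1 / real (Suc j)) + C"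
    unfolding AE_all_countable
    by (intro allI birkhoff_sum_upper_bound[where f = "\<lambda>x. - f x"] T) (simp_all add: f)
  moreover have "AE x in M. ?E (\<lambda>x. - f x) x = - ?E f x"
    using I.real_cond_exp_cmult[OF f, of "-1"] by simp
  ultimately show ?thesis
  proof eventually_elim
    case (elim x)
    show ?case
    proof (rule order_tendstoI)
      fix a assume "?E f x < a"
      then show "\<forall>\<^sub>F n in sequentially. (\<Sum>k<n. f ((T ^^ k) x)) / real n < a"
        using elim(1) by (intro eventually_average_less[where L = "?E f x"]) auto
    next
      fix a assume "a < ?E f x"
      then have "\<forall>\<^sub>F n in sequentially. (\<Sum>k<n. - f ((T ^^ k) x)) / real n < - a"
        using elim(2) unfolding elim(3)
        by (intro eventually_average_less[where L = "- ?E f x"]) auto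
      then show "\<forall>\<^sub>F n in sequentially. a < (\<Sum>k<n. f ((T ^^ k) x)) / real n"
        by (simp add: sum_negf)
    qed
  qed
qed

section \<open>The elephant random walk with \<open>p = 1/2\<close>\<close>

lemma measurable_history:
  assumes "1 \<le> i" "i \<le> n"
  shows "X i \<in> borel_measurable (history M X n)"
proof (rule measurableI)
  fix B :: "real set" assume "B \<in> sets borel"
  then have "X i -` B \<inter> space M \<in> (\<Union>i\<in>{1..n}. {X i -` B \<inter> space M | B. B \<in> sets borel})"
    using assms by (intro UN_I[of i]) auto
  then show "X i -` B \<inter> space (history M X n) \<in> sets (history M X n)"
    unfolding history_def by (subst sets_measure_of) (auto simp: space_measure_of_conv intro!: sigma_sets.Basic)
qed simp

text \<open>For i < j, the centred X_i is measurable for the history up to j - 1, given which the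
  centred X_j has mean 0; this yields orthogonality.\<close>

lemma (in DERW_increments) walk_minus_drift_strong_law:
  assumes p: "p = 1 / 2"
    and a: "\<And>n. n \<ge> 1 \<Longrightarrow> a n \<in> {0..1}"
    and f: "\<And>n. f ((T ^^ n) x) \<in> {0..1}"
  shows "AE \<omega> in M. (\<lambda>n. (walk X n \<omega> - (\<Sum>i = 1..n. (1 - a i) * (2 * f ((T ^^ i) x) - 1))) / real n) \<longlonglongrightarrow> 0"
proof -
  define c where "c i = (1 - a i) * (2 * f ((T ^^ i) x) - 1)" for i
  have X_abs: "\<bar>X i \<omega>\<bar> = 1" if "i \<ge> 1" "\<omega> \<in> space M" for i \<omega>
    using X_values[OF that] by auto
  have bound: "\<bar>X i \<omega> - c i\<bar> \<le> 2" if "i \<ge> 1" "\<omega> \<in> space M" for i \<omega>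
  proof -
    have "\<bar>c i\<bar> \<le> 1 * 1"
      unfolding c_def abs_mult using a[OF that(1)] f[of i] by (intro mult_mono) auto
    then show ?thesis
      using X_abs[OF that] by linarith
  qed
  have orth: "expectation (\<lambda>\<omega>. (X i \<omega> - c i) * (X j \<omega> - c j)) = 0" if ij: "1 \<le> i" "i < j" for i j
  proof -
    obtain n where n: "j = n + 1" "n \<ge> 1" "i \<le> n"
      using ij by (cases j) auto
    interpret H: finite_measure_subalgebra M "history M X n"
      by unfold_locales (rule subalgebra_history[OF X_measurable])
    have [measurable]: "X i \<in> borel_measurable M" "X j \<in> borel_measurable M"
      using ij by (auto intro: X_measurable)
    \<comment> \<open>The conditional probability of \<open>X j = 1\<close>, computed from the mean
      \<open>c j\<close> of a variable with values -1 and 1.\<close>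
    define b where "b = (c j + 1) / 2"
    define I :: "'w \<Rightarrow> real" where "I = indicator {\<omega> \<in> space M. X j \<omega> = 1}"
    have [measurable]: "I \<in> borel_measurable M"
      unfolding I_def by measurable
    have cond: "AE \<omega> in M. real_cond_exp M (history M X n) I \<omega> = b"
    proof -
      \<comment> \<open>The factor \<open>2 * p - 1\<close> vanishes, so the sum equals
        \<open>n\<close> and the memory term is 1/2 whatever the past.\<close>
      have "a j * (1 / (2 * real n) * (\<Sum>k = 1..n. 1 + (2 * p - 1) * X k \<omega> * 1))
          + (1 - a j) * env_step f T x j 1 = b" for \<omega>
        using n by (simp add: p b_def c_def env_step_def field_simps)
      then show ?thesis
        using next_step[of n 1] n by (simp add: I_def)
    qed
    have int: "integrable M (\<lambda>\<omega>. X i \<omega> - c i)"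
      using bound[OF ij(1)] by (intro integrable_const_bound[where B = 2]) auto
    have int_I: "integrable M (\<lambda>\<omega>. (X i \<omega> - c i) * I \<omega>)"
      using bound[OF ij(1)]
      by (intro integrable_const_bound[where B = 2]) (auto simp: I_def indicator_def)
    have meas: "(\<lambda>\<omega>. X i \<omega> - c i) \<in> borel_measurable (history M X n)"
      using measurable_history[OF ij(1) n(3)] by (intro borel_measurable_diff) auto
    \<comment> \<open>A history-measurable factor allows \<open>I\<close> to be replaced by its
      conditional expectation.\<close>
    have "expectation (\<lambda>\<omega>. (X i \<omega> - c i) * I \<omega>) =
        expectation (\<lambda>\<omega>. (X i \<omega> - c i) * real_cond_exp M (history M X n) I \<omega>)"
      by (rule H.real_cond_exp_intg(2)[OF int_I meas, symmetric]) simp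
    also have "\<dots> = expectation (\<lambda>\<omega>. (X i \<omega> - c i) * b)"
      using cond by (intro integral_cong_AE) auto
    finally have eq: "expectation (\<lambda>\<omega>. (X i \<omega> - c i) * I \<omega>) = expectation (\<lambda>\<omega>. (X i \<omega> - c i) * b)" .
    have "X j \<omega> - c j = 2 * (I \<omega> - b)" if "\<omega> \<in> space M" for \<omega>
      using X_values[of j \<omega>] ij that by (auto simp: I_def b_def field_simps)
    then have "expectation (\<lambda>\<omega>. (X i \<omega> - c i) * (X j \<omega> - c j)) =
        expectation (\<lambda>\<omega>. 2 * ((X i \<omega> - c i) * I \<omega> - (X i \<omega> - c i) * b))"
      by (intro Bochner_Integration.integral_cong) (auto simp: right_diff_distrib)
    also have "\<dots> = 2 * (expectation (\<lambda>\<omega>. (X i \<omega> - c i) * I \<omega>) - expectation (\<lambda>\<omega>. (X i \<omega> - c i) * b))"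
      by (subst integral_mult_right_zero, subst Bochner_Integration.integral_diff)
        (use int int_I in \<open>auto intro: integrable_mult_left\<close>)
    finally show ?thesis
      using eq by simp
  qed
  have "AE \<omega> in M. (\<lambda>n. (\<Sum>i = 1..n. X i \<omega> - c i) / real n) \<longlonglongrightarrow> 0"
    by (rule orthogonal_strong_law[where B = 2])
      (use X_measurable bound orth in \<open>auto intro!: borel_measurable_diff\<close>)
  then show ?thesis
    by (simp add: walk_def c_def sum_subtractf)
qed

section \<open>Cesaro averages of the deterministic drift\<close>

lemma tendsto_zero_averages:
  fixes u :: "nat \<Rightarrow> real"
  assumes "u \<longlonglongrightarrow> 0"
  shows "(\<lambda>n. (\<Sum>i = 1..n. u i) / real n) \<longlonglongrightarrow> 0"
proof (rule LIMSEQ_I)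
  fix r :: real assume "0 < r"
  then obtain N where N: "\<And>n. n \<ge> N \<Longrightarrow> \<bar>u n\<bar> < r / 2"
    using LIMSEQ_D[OF assms, of "r / 2"] by auto
  \<comment> \<open>The terms up to \<open>N\<close> contribute at most \<open>C\<close> for every
    \<open>n\<close>; each later one contributes less than \<open>r / 2\<close>.\<close>
  define C where "C = (\<Sum>i = 1..N. \<bar>u i\<bar>)"
  have bound: "\<bar>\<Sum>i = 1..n. u i\<bar> \<le> C + real n * (r / 2)" for n
  proof -
    have "\<bar>\<Sum>i = 1..n. u i\<bar> \<le> (\<Sum>i = 1..n. (if i \<le> N then \<bar>u i\<bar> else 0) + r / 2)"
      using N \<open>0 < r\<close> by (intro order_trans[OF sum_abs] sum_mono) (auto intro: less_imp_le)
    also have "\<dots> = (\<Sum>i \<in> {1..n} \<inter> {..N}. \<bar>u i\<bar>) + real n * (r / 2)"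
      unfolding sum.inter_restrict[OF finite_atLeastAtMost] by (simp add: sum.distrib)
    also have "(\<Sum>i \<in> {1..n} \<inter> {..N}. \<bar>u i\<bar>) \<le> C"
      unfolding C_def by (intro sum_mono2) auto
    finally show ?thesis by simp
  qed
  have "(\<lambda>n. C / real n) \<longlonglongrightarrow> 0"
    by (rule lim_const_over_n)
  then have "\<forall>\<^sub>F n in sequentially. C / real n < r / 2"
    using \<open>0 < r\<close> by (intro order_tendstoD(2)) auto
  then have "\<forall>\<^sub>F n in sequentially. norm ((\<Sum>i = 1..n. u i) / real n - 0) < r"
    using eventually_gt_at_top[of 0]
  proof eventually_elim
    case (elim n)
    have "\<bar>\<Sum>i = 1..n. u i\<bar> / real n \<le> (C + real n * (r / 2)) / real n"
      by (intro divide_right_mono bound) simp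
    also have "\<dots> = C / real n + r / 2"
      using elim by (simp add: add_divide_distrib)
    also have "\<dots> < r"
      using elim(1) by linarith
    finally show ?case
      by simp
  qed
  then show "\<exists>no. \<forall>n\<ge>no. norm ((\<Sum>i = 1..n. u i) / real n - 0) < r"
    by (simp add: eventually_at_top_linorder)
qed

text \<open>Split 1 - a_i = (1 - l) + (l - a_i). The first part averages to the limit; the second is
  a null sequence times factors bounded by 1.\<close>

lemma drift_average_tendsto:
  fixes a v :: "nat \<Rightarrow> real"
  assumes a: "a \<longlonglongrightarrow> l" and v: "\<And>n. v n \<in> {0..1}"
    and L: "(\<lambda>n. (\<Sum>k<n. v k) / real n) \<longlonglongrightarrow> L"
  shows "(\<lambda>n. (\<Sum>i = 1..n. (1 - a i) * (2 * v i - 1)) / real n) \<longlonglongrightarrow> (1 - l) * (2 * L - 1)"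
proof -
  \<comment> \<open>Birkhoff sums run over 0, ..., n-1 but the drift over 1, ..., n; the two
    boundary terms vanish after division by \<open>n\<close>.\<close>
  have shift: "(\<Sum>i = 1..n. v i) = (\<Sum>k<n. v k) + (v n - v 0)" for n
    by (induction n) auto
  have "(\<lambda>n. (v n - v 0) / real n) \<longlonglongrightarrow> 0"
  proof (rule Lim_null_comparison[OF _ lim_const_over_n[of 1]])
    have "\<bar>v n - v 0\<bar> \<le> 1" for n
      using v[of n] v[of 0] by auto
    then show "\<forall>\<^sub>F n in sequentially. norm ((v n - v 0) / real n) \<le> 1 / real n"
      by (simp add: divide_right_mono)
  qed
  moreover have "(\<lambda>n. (\<Sum>i = 1..n. (l - a i) * (2 * v i - 1)) / real n) \<longlonglongrightarrow> 0"
  proof (rule tendsto_zero_averages, rule Lim_null_comparison)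
    show "(\<lambda>n. \<bar>l - a n\<bar>) \<longlonglongrightarrow> 0"
      using tendsto_rabs[OF tendsto_diff[OF tendsto_const a, of l]] by simp
    have "\<bar>2 * v n - 1\<bar> \<le> 1" for n
      using v[of n] by auto
    then show "\<forall>\<^sub>F n in sequentially. norm ((l - a n) * (2 * v n - 1)) \<le> \<bar>l - a n\<bar>"
      by (simp add: abs_mult mult_left_le)
  qed
  ultimately have "(\<lambda>n. (1 - l) * (2 * ((\<Sum>k<n. v k) / real n + (v n - v 0) / real n) - 1)
      + (\<Sum>i = 1..n. (l - a i) * (2 * v i - 1)) / real n) \<longlonglongrightarrow> (1 - l) * (2 * (L + 0) - 1) + 0"
    by (intro tendsto_intros L)
  \<comment> \<open>Stated only eventually: cancelling \<open>real n / real n\<close> requires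
    \<open>n > 0\<close>.\<close>
  moreover have "\<forall>\<^sub>F n in sequentially.
      (1 - l) * (2 * ((\<Sum>k<n. v k) / real n + (v n - v 0) / real n) - 1)
        + (\<Sum>i = 1..n. (l - a i) * (2 * v i - 1)) / real n
      = (\<Sum>i = 1..n. (1 - a i) * (2 * v i - 1)) / real n"
    using eventually_gt_at_top[of 0]
  proof eventually_elim
    case (elim n)
    have "(\<Sum>i = 1..n. (1 - a i) * (2 * v i - 1))
        = (\<Sum>i = 1..n. (1 - l) * (2 * v i - 1) + (l - a i) * (2 * v i - 1))"
      by (intro sum.cong) (auto simp: algebra_simps)
    also have "\<dots> = (1 - l) * (2 * (\<Sum>i = 1..n. v i) - real n) + (\<Sum>i = 1..n. (l - a i) * (2 * v i - 1))"
      by (simp add: sum.distrib sum_distrib_left[symmetric] sum_subtractf)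
    finally show ?case
      using elim unfolding shift by (simp add: field_simps)
  qed
  ultimately show ?thesis
    by (simp add: tendsto_cong)
qed

section \<open>Combining fluctuations and drift\<close>

theorem corollary2:
  fixes \<mu> :: "'a measure"
    and T :: "'a \<Rightarrow> 'a"
    and f :: "'a \<Rightarrow> real"
    and R :: "(real \<times> nat) set"
    and g :: "real \<times> nat \<Rightarrow> real"
    and \<alpha> l p q :: real
    and P :: "'a \<Rightarrow> 'w measure"
    and X :: "nat \<Rightarrow> 'w \<Rightarrow> real"
  assumes "prob_space \<mu>"
    and "T \<in> measurable \<mu> \<mu>"
    and "\<And>A. A \<in> sets \<mu> \<Longrightarrow> emeasure \<mu> (T -` A \<inter> space \<mu>) = emeasure \<mu> A"
    and "f \<in> borel_measurable \<mu>"
    and "\<And>x. x \<in> space \<mu> \<Longrightarrow> f x \<in> {0..1}"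
    and "p \<in> {0..1}" and "q \<in> {0..1}"
    and "\<And>r. r \<in> R \<Longrightarrow> g r \<in> {0..1}"
    and "\<And>n. n \<ge> 1 \<Longrightarrow> (\<alpha>, n) \<in> R"
    and "\<And>x. x \<in> space \<mu> \<Longrightarrow> DERW_increments (P x) X f T (\<lambda>n. g (\<alpha>, n)) p q x"
    and "p = 1 / 2"
    and "(\<lambda>n. g (\<alpha>, n)) \<longlonglongrightarrow> l"
    and "l > 0"
  shows "AE x in \<mu>. AE \<omega> in P x.
    (\<lambda>n. walk X n \<omega> / real n)
      \<longlonglongrightarrow> (1 - l) * (2 * real_cond_exp \<mu> (invariant_algebra \<mu> T) f x - 1)"
proof -
  interpret prob_space \<mu> by fact
  define a where "a = (\<lambda>n. g (\<alpha>, n))"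
  have T: "T \<in> measurable \<mu> \<mu>" "distr \<mu> \<mu> T = \<mu>"
    using assms(2,3) by (auto intro!: measure_eqI simp: emeasure_distr)
  have f: "integrable \<mu> f"
    using assms(4,5) by (intro integrable_const_bound[where B = 1]) auto
  \<comment> \<open>Exceptional points \<open>x\<close> arise only from Birkhoff's theorem; for
    every other \<open>x\<close> in the space, the strong law holds almost surely under
    \<open>P x\<close>.\<close>
  show ?thesis
    using AE_space birkhoff_ergodic[OF T f]
  proof eventually_elim
    case (elim x)
    note x = elim(1) and birkhoff = elim(2)
    interpret D: DERW_increments "P x" X f T a p q x
      unfolding a_def by (rule assms(10)[OF x])
    have a01: "a n \<in> {0..1}" if "n \<ge> 1" for n
      unfolding a_def by (intro assms(8,9) that)
    have f01: "f ((T ^^ n) x) \<in> {0..1}" for n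
      by (intro assms(5) funpow_in_space[OF T(1) x])
    have drift: "(\<lambda>n. (\<Sum>i = 1..n. (1 - a i) * (2 * f ((T ^^ i) x) - 1)) / real n)
        \<longlonglongrightarrow> (1 - l) * (2 * real_cond_exp \<mu> (invariant_algebra \<mu> T) f x - 1)"
      using assms(12) unfolding a_def[symmetric]
      by (intro drift_average_tendsto f01 birkhoff)
    have "AE \<omega> in P x. (\<lambda>n. (walk X n \<omega>
        - (\<Sum>i = 1..n. (1 - a i) * (2 * f ((T ^^ i) x) - 1))) / real n) \<longlonglongrightarrow> 0"
      by (rule D.walk_minus_drift_strong_law[OF assms(11) a01 f01])
    then show "AE \<omega> in P x. (\<lambda>n. walk X n \<omega> / real n)
        \<longlonglongrightarrow> (1 - l) * (2 * real_cond_exp \<mu> (invariant_algebra \<mu> T) f x - 1)"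
    proof eventually_elim
      case (elim \<omega>)
      from tendsto_add[OF this drift] show ?case
        by (simp add: diff_divide_distrib)
    qed
  qed
qed

end
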